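(* Let $(\Omega,\mathcal{F},m,T)$ be an ergodic and aperiodic probability preserving system, and let $f:\Omega\to\mathbb{Z}^2$ be the function constructed in the context. Then for all $N\in\mathbb{N}$, \[ m\Big(\big|\{S_{j+N}(f)-S_N(f):\ -N\leq j\leq N\}\big|=2N+1\Big)>0 . \]
   Context: $\mathbb{N}=\{1,2,\dots\}$ and $|\cdot|$ denotes cardinality. For $n\geq 1$, $S_n(f)=\sum_{k=0}^{n-1}f\circ T^k$, and $S_0(f)=(0,0)$. Construction of $f$. For $k\in\mathbb{N}$ let $p_k=2^k$ if $k$ is even and $p_k=2^k+1$ if $k$ is odd; let $d_k=2^{k^2}$; let $\alpha_1=\frac12$ and $\alpha_k=\frac{1}{p_k\sqrt{k\log k}}$ for $k\geq 2$. It is known that for every ergodic aperiodic probability preserving system $(\Omega,\mathcal{F},m,T)$ there exist measurable functions $\bar f_k^{(i)}:\Omega\to\{-1,0,1\}$, $k\in\mathbb{N}$, $i\in\{1,2\}$, such that: (a) for all $k\in\mathbb{N}$, $i\in\{1,2\}$: $m(\bar f_k^{(i)}=1)=m(\bar f_k^{(i)}=-1)=\frac{\alpha_k^2}{2}$; (b) for every $k\in\mathbb{N}$, the functions $\{\bar f_k^{(i)}\circ T^j:\ 0\leq j\leq 2d_k+p_k,\ i\in\{1,2\}\}$ are i.i.d.; (c) for every $k\in\mathbb{N}$, the functions $\{\bar f_k^{(i)}\circ T^j:\ 0\leq j\leq 2d_k+p_k,\ i\in\{1,2\}\}$ are independent of the family $\{\bar f_l^{(i)}\circ T^j:\ 1\leq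 l<k,\ i\in\{1,2\},\ 0\leq j\leq 2d_k+p_k\}$. Fix such functions and for $i\in\{1,2\}$, $k\in\mathbb{N}$ set \[ f_k^{(i)}=\sum_{j=0}^{p_k-1}\Big(\bar f_k^{(i)}\circ T^j-\bar f_k^{(i)}\circ T^{d_k+j}\Big),\qquad f^{(i)}=\sum_{k=1}^\infty f_k^{(i)},\qquad f=(f^{(1)},f^{(2)}):\Omega\to\mathbb{Z}^2 . \] It is known that $f$ is well defined ($m$-almost everywhere). *)

theory Defs
  imports "HOL-Probability.Probability"
begin

text \<open>
  The map \<open>T\<close> is not required to be invertible. Aperiodicity is stated through \<open>AE\<close>, since on a
  general measurable space the set of periodic points need not be measurable.
\<close>

locale ergodic_aperiodic_pps = prob_space M for M :: "'a measure" +
  fixes T :: "'a \<Rightarrow> 'a"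
  assumes measurable_T: "T \<in> measurable M M"
    and distr_T: "distr M M T = M"
    and ergodic: "\<And>A. A \<in> sets M \<Longrightarrow> T -` A \<inter> space M = A \<Longrightarrow> prob A = 0 \<or> prob A = 1"
    and aperiodic: "\<And>n. n \<ge> 1 \<Longrightarrow> AE x in M. (T ^^ n) x \<noteq> x"

definition pseq :: "nat \<Rightarrow> nat" where
  "pseq k = (if even k then 2 ^ k else 2 ^ k + 1)"

definition dseq :: "nat \<Rightarrow> nat" where
  "dseq k = 2 ^ (k ^ 2)"

definition alpha :: "nat \<Rightarrow> real" where
  "alpha k = (if k = 1 then 1 / 2 else 1 / (real (pseq k) * sqrt (real k * ln (real k))))"

text \<open>
  A sequence of base functions is given as \<open>g k i\<close> for \<open>k \<ge> 1\<close> and \<open>i \<in> {1, 2}\<close>;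
  the values at other indices are irrelevant. A triple \<open>(l, i, j)\<close> indexes the function
  \<open>g l i \<circ> T ^^ j\<close>.
\<close>

definition orbit_var ::
    "('a \<Rightarrow> 'a) \<Rightarrow> (nat \<Rightarrow> nat \<Rightarrow> 'a \<Rightarrow> int) \<Rightarrow> nat \<times> nat \<times> nat \<Rightarrow> 'a \<Rightarrow> int" where
  "orbit_var T g = (\<lambda>(l, i, j) x. g l i ((T ^^ j) x))"

definition current_idx :: "nat \<Rightarrow> (nat \<times> nat \<times> nat) set" where
  "current_idx k = {k} \<times> {1, 2} \<times> {0..2 * dseq k + pseq k}"

definition earlier_idx :: "nat \<Rightarrow> (nat \<times> nat \<times> nat) set" where
  "earlier_idx k = {1..<k} \<times> {1, 2} \<times> {0..2 * dseq k + pseq k}"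

text \<open>
  Independence of two families of functions is independence of the two random vectors that they
  form.
\<close>

locale base_functions = ergodic_aperiodic_pps M T
  for M :: "'a measure" and T :: "'a \<Rightarrow> 'a" +
  fixes g :: "nat \<Rightarrow> nat \<Rightarrow> 'a \<Rightarrow> int"
  assumes measurable_g:
      "\<And>k i. k \<ge> 1 \<Longrightarrow> i \<in> {1, 2} \<Longrightarrow> g k i \<in> measurable M (count_space UNIV)"
    and range_g:
      "\<And>k i x. k \<ge> 1 \<Longrightarrow> i \<in> {1, 2} \<Longrightarrow> x \<in> space M \<Longrightarrow> g k i x \<in> {-1, 0, 1}"
    and prob_pos:
      "\<And>k i. k \<ge> 1 \<Longrightarrow> i \<in> {1, 2} \<Longrightarrow> prob {x \<in> space M. g k i x = 1} = (alpha k)\<^sup>2 / 2"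
    and prob_neg:
      "\<And>k i. k \<ge> 1 \<Longrightarrow> i \<in> {1, 2} \<Longrightarrow> prob {x \<in> space M. g k i x = -1} = (alpha k)\<^sup>2 / 2"
    and independent_current:
      "\<And>k. k \<ge> 1 \<Longrightarrow>
        indep_vars (\<lambda>_. count_space UNIV) (orbit_var T g) (current_idx k)"
    and identically_distributed_current:
      "\<And>k u v. k \<ge> 1 \<Longrightarrow> u \<in> current_idx k \<Longrightarrow> v \<in> current_idx k \<Longrightarrow>
        distr M (count_space UNIV) (orbit_var T g u) = distr M (count_space UNIV) (orbit_var T g v)"
    and independent_of_earlier:
      "\<And>k. k \<ge> 1 \<Longrightarrow>
        indep_var
          (\<Pi>\<^sub>M u\<in>current_idx k. count_space UNIV) (\<lambda>x. \<lambda>u\<in>current_idx k. orbit_var T g u x)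
          (\<Pi>\<^sub>M u\<in>earlier_idx k. count_space UNIV) (\<lambda>x. \<lambda>u\<in>earlier_idx k. orbit_var T g u x)"

definition block :: "('a \<Rightarrow> 'a) \<Rightarrow> (nat \<Rightarrow> nat \<Rightarrow> 'a \<Rightarrow> int) \<Rightarrow> nat \<Rightarrow> nat \<Rightarrow> 'a \<Rightarrow> int" where
  "block T g k i x =
    (\<Sum>j<pseq k. g k i ((T ^^ j) x) - g k i ((T ^^ (dseq k + j)) x))"

text \<open>
  The series runs over \<open>k \<ge> 1\<close>. It is an infinite sum in the discrete space \<open>int\<close>, so it converges
  exactly where only finitely many terms are nonzero, which is the case almost everywhere.
\<close>

definition cocycle_component ::
    "('a \<Rightarrow> 'a) \<Rightarrow> (nat \<Rightarrow> nat \<Rightarrow> 'a \<Rightarrow> int) \<Rightarrow> nat \<Rightarrow> 'a \<Rightarrow> int" where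
  "cocycle_component T g i x = (\<Sum>k. block T g (Suc k) i x)"

definition cocycle :: "('a \<Rightarrow> 'a) \<Rightarrow> (nat \<Rightarrow> nat \<Rightarrow> 'a \<Rightarrow> int) \<Rightarrow> 'a \<Rightarrow> int \<times> int" where
  "cocycle T g x = (cocycle_component T g 1 x, cocycle_component T g 2 x)"

definition birkhoff_sum :: "('a \<Rightarrow> 'a) \<Rightarrow> ('a \<Rightarrow> int \<times> int) \<Rightarrow> nat \<Rightarrow> 'a \<Rightarrow> int \<times> int" where
  "birkhoff_sum T f n x = (\<Sum>k<n. f ((T ^^ k) x))"

end

(*
  It suffices that the first coordinate of f is positive at x, T x, ..., T^(2N-1) x, because then
  the first coordinates of S_0(f), ..., S_2N(f) are strictly increasing.

  The windows of the different levels are mutually independent, so one may prescribe the base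
  functions on them level by level. Choose m large. At the levels m + 1 and m + 2 prescribe that
  the base function is 1 before time d_k and -1 from time d_k on; each of these two
  blocks then takes its maximal value 2 p_k along the orbit piece, and as p_k is about 2^k the two
  together outweigh the levels up to m, which are bounded below by -2 p_k and are left free.
  At all levels above m + 2 prescribe that the base function vanishes on the part of the
  window that enters the block. The prescriptions up to level m + 2 have positive probability, and
  the later ones fail with summable probabilities O(p_k alpha_k^2), with sum at most 1/2.
*)

theory Submission
  imports Defs
begin

section \<open>Measurability of integer-valued sums and series\<close>

lemma measurable_binop_countable:
  fixes h :: "'b :: countable \<Rightarrow> 'c :: countable \<Rightarrow> 'd"
  assumes "f \<in> measurable M (count_space UNIV)" and "f' \<in> measurable M (count_space UNIV)"
  shows "(\<lambda>x. h (f x) (f' x)) \<in> measurable M (count_space UNIV)"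
  by (rule measurable_compose_countable[OF measurable_compose_countable[OF _ assms(2)] assms(1)])
    simp

lemma measurable_sum_int:
  fixes f :: "'i \<Rightarrow> 'a \<Rightarrow> int"
  assumes "\<And>i. i \<in> I \<Longrightarrow> f i \<in> measurable M (count_space UNIV)"
  shows "(\<lambda>x. \<Sum>i\<in>I. f i x) \<in> measurable M (count_space UNIV)"
  using assms
  by (induction I rule: infinite_finite_induct) (auto intro: measurable_binop_countable[where h="(+)"])

text \<open>Convergence in a discrete space means being eventually constant. This turns the limit
  into a description by countably many conditions on partial sums, from which measurability can be
  read off even at points of divergence.\<close>

lemma int_suminf_eq_The:
  fixes f :: "nat \<Rightarrow> int"
  shows "suminf f = (THE s. \<exists>n. \<forall>m\<ge>n. (\<Sum>k<m. f k) = s)"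
  unfolding suminf_def sums_def tendsto_discrete eventually_sequentially ..

lemma measurable_suminf_int:
  fixes f :: "nat \<Rightarrow> 'a \<Rightarrow> int"
  assumes "\<And>i. f i \<in> measurable M (count_space UNIV)"
  shows "(\<lambda>x. \<Sum>i. f i x) \<in> measurable M (count_space UNIV)"
proof -
  have [measurable]: "(\<lambda>x. \<Sum>k<m. f k x) \<in> measurable M (count_space UNIV)" for m
    by (rule measurable_sum_int) (rule assms)
  show ?thesis
    unfolding int_suminf_eq_The
  proof (rule measurable_THE[where I=UNIV])
    fix x i j
    assume "\<exists>n. \<forall>m\<ge>n. (\<Sum>k<m. f k x) = i" and "\<exists>n. \<forall>m\<ge>n. (\<Sum>k<m. f k x) = j"
    then obtain n n' where "\<And>m. m \<ge> n \<Longrightarrow> (\<Sum>k<m. f k x) = i"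
      and "\<And>m. m \<ge> n' \<Longrightarrow> (\<Sum>k<m. f k x) = j"
      by blast
    from this(1)[of "max n n'"] this(2)[of "max n n'"] show "i = j"
      by simp
  qed simp_all
qed

section \<open>Elementary estimates for \<open>pseq\<close>, \<open>dseq\<close> and
  \<open>alpha\<close>\<close>

lemma finite_current_idx [simp]: "finite (current_idx k)"
  by (simp add: current_idx_def)

lemma pseq_bounds: "2 ^ k \<le> pseq k" "pseq k \<le> 2 ^ k + 1"
  by (auto simp: pseq_def)

lemma pseq_pos: "0 < pseq k"
  by (simp add: pseq_def)

lemma dseq_mono: "k \<le> l \<Longrightarrow> dseq k \<le> dseq l"
  by (simp add: dseq_def power_increasing power_mono)

lemma pseq_mono: "k \<le> l \<Longrightarrow> pseq k \<le> pseq l"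
proof (cases "k = l")
  case False
  assume "k \<le> l"
  \<comment> \<open>Doubling leaves room for the extra 1 that \<open>pseq\<close> carries at odd
    indices.\<close>
  with False have "(2::nat) ^ Suc k \<le> 2 ^ l"
    by (intro power_increasing) auto
  moreover have "(1::nat) \<le> 2 ^ k"
    by simp
  ultimately show ?thesis
    using pseq_bounds(2)[of k] pseq_bounds(1)[of l] unfolding power_Suc by linarith
qed simp

lemma current_idx_subset_earlier_idx:
  assumes "1 \<le> l" "l < k"
  shows "current_idx l \<subseteq> earlier_idx k"
  using assms dseq_mono[of l k] pseq_mono[of l k]
  by (auto simp: current_idx_def earlier_idx_def)

text \<open>The left side is at most \<open>2 ^ (m + 1) - 2 + m\<close>. The odd levels contribute
  about m/2 beyond the powers of 2, so for large \<open>m\<close> the single term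
  \<open>pseq (Suc m)\<close> would be too small; this is why two levels are made extremal.\<close>

lemma sum_pseq_less: "(\<Sum>k<m. pseq (Suc k)) < pseq (Suc m) + pseq (Suc (Suc m))"
proof -
  have "(\<Sum>k<m. pseq (Suc k)) \<le> (\<Sum>k<m. 2 ^ Suc k + 1)"
    by (intro sum_mono pseq_bounds)
  also have "\<dots> + 2 = 2 ^ Suc m + m"
    by (induction m) auto
  finally have "(\<Sum>k<m. pseq (Suc k)) + 2 \<le> 2 ^ Suc m + m"
    by simp
  moreover have "m < 2 ^ m"
    by (rule less_exp)
  ultimately show ?thesis
    using pseq_bounds(1)[of "Suc m"] pseq_bounds(1)[of "Suc (Suc m)"] unfolding power_Suc by linarith
qed

lemma alpha_pos: "k \<ge> 1 \<Longrightarrow> alpha k > 0"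
  by (auto simp: alpha_def pseq_pos intro!: divide_pos_pos mult_pos_pos)

text \<open>The left side equals 1 / (p_k k ln k), and k ln k \<ge> 1 because k \<ge> 3 \<ge> e.
  This makes the failure probabilities of the high levels geometrically summable.\<close>

lemma alpha_sq_le:
  assumes "k \<ge> 3"
  shows "real (pseq k) * (alpha k)\<^sup>2 \<le> 1 / 2 ^ k"
proof -
  have "exp 1 \<le> (3::real)"
    by (rule exp_le)
  then have "1 \<le> ln (real k)"
    using assms by (subst ln_ge_iff) auto
  with assms have 1: "1 \<le> real k * ln (real k)"
    using mult_mono[of 1 "real k" 1 "ln (real k)"] by simp
  have p: "(2::real) ^ k \<le> real (pseq k)" "real (pseq k) > 0"
    using pseq_bounds(1)[of k] by (metis of_nat_le_iff of_nat_numeral of_nat_power) (simp add: pseq_pos)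
  have "real (pseq k) * (alpha k)\<^sup>2 = 1 / (real (pseq k) * (real k * ln (real k)))"
    using assms p 1 by (simp add: alpha_def power_mult_distrib power2_eq_square field_simps)
  also have "\<dots> \<le> 1 / (2 ^ k * 1)"
    using 1 p by (intro divide_left_mono mult_mono) auto
  finally show ?thesis
    by simp
qed

section \<open>Measurability, laws, and independence across levels\<close>

context base_functions
begin

lemma measurable_orbit_var:
  assumes "k \<ge> 1" "i \<in> {1, 2}"
  shows "orbit_var T g (k, i, j) \<in> measurable M (count_space UNIV)"
  using measurable_compose[OF measurable_compose_n[OF measurable_T] measurable_g[OF assms]]
  by (simp add: orbit_var_def)

lemma measurable_orbit_var_current:
  assumes "k \<ge> 1" "u \<in> current_idx k"
  shows "orbit_var T g u \<in> measurable M (count_space UNIV)"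
  using assms measurable_orbit_var by (auto simp: current_idx_def)

lemma measurable_block:
  assumes "k \<ge> 1" "i \<in> {1, 2}"
  shows "block T g k i \<in> measurable M (count_space UNIV)"
proof -
  have "(\<lambda>x. \<Sum>j<pseq k. orbit_var T g (k, i, j) x - orbit_var T g (k, i, dseq k + j) x)
      \<in> measurable M (count_space UNIV)"
    by (intro measurable_sum_int measurable_binop_countable[where h="(-)"] measurable_orbit_var assms)
  then show ?thesis
    by (simp add: block_def[abs_def] orbit_var_def)
qed

lemma measurable_cocycle: "cocycle T g \<in> measurable M (count_space UNIV)"
proof -
  have "cocycle_component T g i \<in> measurable M (count_space UNIV)" if "i \<in> {1, 2}" for i
    unfolding cocycle_component_def[abs_def]
    using that by (intro measurable_suminf_int measurable_block) auto
  then show ?thesis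
    unfolding cocycle_def[abs_def] by (intro measurable_binop_countable[where h=Pair]) auto
qed

lemma measurable_birkhoff_sum:
  "birkhoff_sum T (cocycle T g) n \<in> measurable M (count_space UNIV)"
proof (induction n)
  case (Suc n)
  have "(\<lambda>x. cocycle T g ((T ^^ n) x)) \<in> measurable M (count_space UNIV)"
    by (rule measurable_compose[OF measurable_compose_n[OF measurable_T] measurable_cocycle])
  from measurable_binop_countable[OF Suc this, where h="(+)"] show ?case
    by (simp add: birkhoff_sum_def[abs_def])
qed (simp add: birkhoff_sum_def[abs_def])

lemma prob_orbit_var:
  assumes "k \<ge> 1" "u \<in> current_idx k"
  shows "prob {x \<in> space M. orbit_var T g u x \<in> A} = prob {x \<in> space M. g k 1 x \<in> A}"
proof -
  have 0: "(k, 1, 0) \<in> current_idx k"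
    by (simp add: current_idx_def)
  note m = measurable_orbit_var_current[OF \<open>k \<ge> 1\<close>]
  have law: "prob {x \<in> space M. orbit_var T g v x \<in> A} =
      measure (distr M (count_space UNIV) (orbit_var T g v)) A" if "v \<in> current_idx k" for v
    using measure_distr[OF m[OF that], of A] by (simp add: vimage_def Int_def conj_commute)
  have "prob {x \<in> space M. orbit_var T g u x \<in> A} =
      prob {x \<in> space M. orbit_var T g (k, 1, 0) x \<in> A}"
    unfolding law[OF assms(2)] law[OF 0]
    using identically_distributed_current[OF assms 0] by simp
  then show ?thesis
    by (simp add: orbit_var_def)
qed

lemma prob_current_idx:
  assumes "k \<ge> 1"
  shows "prob {x \<in> space M. \<forall>u\<in>current_idx k. orbit_var T g u x \<in> V u} =
    (\<Prod>u\<in>current_idx k. prob {x \<in> space M. orbit_var T g u x \<in> V u})"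
proof -
  have ne: "current_idx k \<noteq> {}"
    by (auto simp: current_idx_def)
  have "prob (\<Inter>u\<in>current_idx k. orbit_var T g u -` V u \<inter> space M) =
      (\<Prod>u\<in>current_idx k. prob (orbit_var T g u -` V u \<inter> space M))"
    by (rule indep_varsD_finite[OF independent_current[OF assms] ne]) auto
  moreover have "(\<Inter>u\<in>current_idx k. orbit_var T g u -` V u \<inter> space M) =
      {x \<in> space M. \<forall>u\<in>current_idx k. orbit_var T g u x \<in> V u}"
    using ne by auto
  ultimately show ?thesis
    by (simp add: vimage_def Int_def conj_commute)
qed

text \<open>Induction on \<open>L\<close>: the window of level \<open>L\<close> is independent of
  the earlier functions observed for equally many times, and these observations include the shorter
  windows of all lower levels. The step-by-step independence thus becomes a product formula.\<close>

lemma prob_levels: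
  "prob {x \<in> space M. \<forall>l\<in>{1..<L}. \<forall>u\<in>current_idx l. orbit_var T g u x \<in> V u} =
    (\<Prod>l\<in>{1..<L}. \<Prod>u\<in>current_idx l. prob {x \<in> space M. orbit_var T g u x \<in> V u})"
proof (induction L)
  case 0
  then show ?case
    by (simp add: prob_space)
next
  case (Suc L)
  show ?case
  proof (cases "L = 0")
    case True
    then show ?thesis
      by (simp add: prob_space)
  next
    case False
    then have L: "L \<ge> 1"
      by simp
    let ?P = "\<lambda>I. \<Pi>\<^sub>M u\<in>I. count_space (UNIV :: int set)"
    let ?X = "\<lambda>I x. \<lambda>u\<in>I. orbit_var T g u x"
    \<comment> \<open>Independence is given for random vectors, so the constraints are encoded as
      measurable sets of vectors.\<close>
    define B where "B = {w \<in> space (?P (current_idx L)). \<forall>u\<in>current_idx L. w u \<in> V u}"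
    define C where "C = {w \<in> space (?P (earlier_idx L)).
      \<forall>l\<in>{1..<L}. \<forall>u\<in>current_idx l. w u \<in> V u}"
    have B: "B \<in> sets (?P (current_idx L))"
      unfolding B_def by measurable
    have C: "C \<in> sets (?P (earlier_idx L))"
      unfolding C_def
    proof (intro sets.sets_Collect_finite_All)
      fix l u assume "l \<in> {1..<L}" "u \<in> current_idx l"
      then have [measurable]: "u \<in> earlier_idx L"
        using current_idx_subset_earlier_idx[of l L] by auto
      show "{w \<in> space (?P (earlier_idx L)). w u \<in> V u} \<in> sets (?P (earlier_idx L))"
        by measurable
    qed auto
    have sub: "u \<in> earlier_idx L" if "l \<in> {1..<L}" "u \<in> current_idx l" for l u
      using that current_idx_subset_earlier_idx[of l L] by auto
    have eqB: "?X (current_idx L) -` B \<inter> space M =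
        {x \<in> space M. \<forall>u\<in>current_idx L. orbit_var T g u x \<in> V u}"
      by (auto simp: B_def space_PiM)
    have eqC: "?X (earlier_idx L) -` C \<inter> space M =
        {x \<in> space M. \<forall>l\<in>{1..<L}. \<forall>u\<in>current_idx l. orbit_var T g u x \<in> V u}"
      using sub by (auto simp: C_def space_PiM)
    have "prob {x \<in> space M. \<forall>l\<in>{1..<Suc L}. \<forall>u\<in>current_idx l. orbit_var T g u x \<in> V u} =
      prob ((\<lambda>x. (?X (current_idx L) x, ?X (earlier_idx L) x)) -` (B \<times> C) \<inter> space M)"
    proof -
      have "{x \<in> space M. \<forall>l\<in>{1..<Suc L}. \<forall>u\<in>current_idx l. orbit_var T g u x \<in> V u} =
        (?X (current_idx L) -` B \<inter> space M) \<inter> (?X (earlier_idx L) -` C \<inter> space M)"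
        unfolding eqB eqC using L by (auto simp: atLeastLessThanSuc)
      then show ?thesis
        by (auto intro: arg_cong[where f=prob])
    qed
    also have "\<dots> = prob (?X (current_idx L) -` B \<inter> space M) * prob (?X (earlier_idx L) -` C \<inter> space M)"
      by (rule indep_varD[OF independent_of_earlier[OF L] B C])
    also have "\<dots> = (\<Prod>l\<in>{1..<Suc L}. \<Prod>u\<in>current_idx l. prob {x \<in> space M. orbit_var T g u x \<in> V u})"
      unfolding eqB eqC Suc prob_current_idx[OF L] using L by (simp add: atLeastLessThanSuc)
    finally show ?thesis .
  qed
qed


lemma prob_zero:
  assumes "k \<ge> 1"
  shows "prob {x \<in> space M. g k 1 x \<in> {0}} = 1 - (alpha k)\<^sup>2"
proof -
  note [measurable] = measurable_g[OF assms, of 1, simplified]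
  let ?E = "\<lambda>v. {x \<in> space M. g k 1 x = v}"
  have "prob (?E 1 \<union> ?E (-1)) = prob (?E 1) + prob (?E (-1))"
    by (rule finite_measure_Union) auto
  also have "\<dots> = (alpha k)\<^sup>2"
    using prob_pos[OF assms, of 1] prob_neg[OF assms, of 1] by simp
  finally have "prob (space M - (?E 1 \<union> ?E (-1))) = 1 - (alpha k)\<^sup>2"
    by (subst prob_compl) auto
  moreover have "space M - (?E 1 \<union> ?E (-1)) = {x \<in> space M. g k 1 x \<in> {0}}"
    using range_g[OF assms, of 1] by auto
  ultimately show ?thesis
    by simp
qed

end

section \<open>The prescribed values and their probability\<close>

text \<open>
  The prescribed values of \<open>orbit_var T g (l, i, j)\<close>; \<open>UNIV\<close> means that there is no constraint.
\<close>

definition favourable :: "nat \<Rightarrow> nat \<Rightarrow> nat \<times> nat \<times> nat \<Rightarrow> int set" where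
  "favourable N m = (\<lambda>(l, i, j).
    if i \<noteq> 1 \<or> l \<le> m then UNIV
    else if l \<le> m + 2 then (if j < dseq l then {1} else {-1})
    else if j < pseq l + 2 * N \<or> dseq l \<le> j \<and> j < dseq l + pseq l + 2 * N then {0}
    else UNIV)"

text \<open>For times below \<open>2 * N\<close> a block reads positions below
  \<open>pseq l + 2 * N\<close> and their shifts by \<open>dseq l\<close>. The second bound
  separates the two ranges and keeps both inside the window of level \<open>l\<close>; the first
  limits their total size to \<open>4 * pseq l\<close>.\<close>

lemma window_bounds:
  assumes "2 * N + 2 \<le> m" "m < l"
  shows "2 * N \<le> pseq l" "pseq l + 2 * N \<le> dseq l"
proof -
  have "l < 2 ^ l"
    by (rule less_exp)
  with assms pseq_bounds(1)[of l] show "2 * N \<le> pseq l"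
    by linarith
  have "l + 2 \<le> 3 * l" "3 * l \<le> l * l"
    using assms by auto
  then have "(2::nat) ^ (l + 2) \<le> 2 ^ (l\<^sup>2)"
    unfolding power2_eq_square by (intro power_increasing) linarith+
  then have "4 * 2 ^ l \<le> dseq l"
    by (simp add: dseq_def)
  then show "pseq l + 2 * N \<le> dseq l"
    using assms \<open>l < 2 ^ l\<close> pseq_bounds(2)[of l] by linarith
qed

lemma sum_geometric_le: "(\<Sum>l\<in>{n..<L}. 4 / 2 ^ l) \<le> 8 / (2 ^ n :: real)"
proof (cases "n \<le> L")
  case True
  then have "(\<Sum>l\<in>{n..<L}. 4 / 2 ^ l) = 8 / (2 ^ n :: real) - 8 / 2 ^ L"
    by (induction rule: dec_induct) simp_all
  then show ?thesis
    by simp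
qed simp

context base_functions
begin

text \<open>The window is finite, and each constraint is either void or asks for the value 1 or -1,
  which has probability \<open>(alpha l)\<^sup>2 / 2\<close>.\<close>

lemma prob_favourable_positive:
  assumes "1 \<le> l" "l \<le> m + 2"
  shows "0 < (\<Prod>u\<in>current_idx l. prob {x \<in> space M. orbit_var T g u x \<in> favourable N m u})"
proof (rule prod_pos)
  fix u assume u: "u \<in> current_idx l"
  have "0 < (alpha l)\<^sup>2 / 2"
    using alpha_pos[OF assms(1)] by simp
  then have pos: "0 < prob {x \<in> space M. g l 1 x = 1}" "0 < prob {x \<in> space M. g l 1 x = - 1}"
    by (simp_all only: prob_pos prob_neg assms(1) insertI1)
  from u obtain i j where "u = (l, i, j)"
    by (auto simp: current_idx_def)
  then have "favourable N m u \<in> {UNIV, {1}, {-1}}"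
    using assms by (simp add: favourable_def)
  then consider "favourable N m u = UNIV" | "favourable N m u = {1}" | "favourable N m u = {-1}"
    by blast
  then show "0 < prob {x \<in> space M. orbit_var T g u x \<in> favourable N m u}"
    unfolding prob_orbit_var[OF assms(1) u]
    using pos by cases (simp_all add: prob_space)
qed

text \<open>At most \<open>4 * pseq l\<close> indices are constrained, each failing with probability
  \<open>(alpha l)\<^sup>2\<close>. The Weierstrass inequality bounds the product below by 1 minus
  the sum of these failures.\<close>

lemma prob_favourable_zero:
  assumes "2 * N + 2 \<le> m" "m + 2 < l"
  shows "1 - 4 / 2 ^ l \<le>
    (\<Prod>u\<in>current_idx l. prob {x \<in> space M. orbit_var T g u x \<in> favourable N m u})"
proof -
  have l: "l \<ge> 1" "l \<ge> 3"
    using assms by auto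
  define J where "J = {..<pseq l + 2 * N} \<union> {dseq l..<dseq l + pseq l + 2 * N}"
  define Z where "Z = (\<lambda>j. (l, 1::nat, j)) ` J"
  let ?q = "\<lambda>u. 1 - prob {x \<in> space M. orbit_var T g u x \<in> favourable N m u}"
  have q: "?q u = (if u \<in> Z then (alpha l)\<^sup>2 else 0)" if "u \<in> current_idx l" for u
  proof (cases "u \<in> Z")
    case True
    then have "favourable N m u = {0}"
      using assms by (auto simp: Z_def J_def favourable_def)
    with True show ?thesis
      using prob_orbit_var[OF l(1) that, of "{0}"] prob_zero[OF l(1)] by simp
  next
    case False
    then have "favourable N m u = UNIV"
      using assms that by (auto simp: Z_def J_def favourable_def current_idx_def)
    with False show ?thesis
      by (simp add: prob_space)
  qed
  have "card Z \<le> card J"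
    unfolding Z_def by (rule card_image_le) (simp add: J_def)
  also have "\<dots> \<le> (pseq l + 2 * N) + (pseq l + 2 * N)"
    unfolding J_def by (rule order.trans[OF card_Un_le]) simp
  also have "\<dots> \<le> 4 * pseq l"
    using window_bounds(1)[of N m l] assms by simp
  finally have card: "card Z \<le> 4 * pseq l" .
  have "finite Z"
    by (simp add: Z_def J_def)
  have "(\<Sum>u\<in>current_idx l. ?q u) = (\<Sum>u\<in>current_idx l. if u \<in> Z then (alpha l)\<^sup>2 else 0)"
    by (rule sum.cong) (simp_all add: q)
  also have "\<dots> = real (card (current_idx l \<inter> Z)) * (alpha l)\<^sup>2"
    by (simp add: sum.If_cases)
  also have "\<dots> \<le> real (4 * pseq l) * (alpha l)\<^sup>2"
    using card card_mono[OF \<open>finite Z\<close>, of "current_idx l \<inter> Z"]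
    by (intro mult_right_mono) (auto simp: simp del: of_nat_mult)
  also have "\<dots> \<le> 4 / 2 ^ l"
    using alpha_sq_le[OF l(2)] by simp
  finally have "1 - 4 / 2 ^ l \<le> 1 - (\<Sum>u\<in>current_idx l. ?q u)"
    by simp
  also have "\<dots> \<le> (\<Prod>u\<in>current_idx l. 1 - ?q u)"
    by (rule Weierstrass_prod_ineq) simp
  finally show ?thesis
    by simp
qed

definition favourable_event :: "nat \<Rightarrow> nat \<Rightarrow> 'a set" where
  "favourable_event N m = {x \<in> space M.
    \<forall>l\<ge>1. \<forall>u\<in>current_idx l. orbit_var T g u x \<in> favourable N m u}"

text \<open>Continuity from above: the events \<open>E L\<close>, which constrain only the levels
  below \<open>L\<close>, decrease to the favourable event, and their probabilities stay above half
  of the positive factor \<open>c\<close> of the levels up to \<open>m + 2\<close>.\<close>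

lemma prob_favourable_event:
  assumes "2 * N + 2 \<le> m"
  shows "0 < prob (favourable_event N m)"
proof -
  define w where
    "w l = (\<Prod>u\<in>current_idx l. prob {x \<in> space M. orbit_var T g u x \<in> favourable N m u})" for l
  define E where "E L = {x \<in> space M.
    \<forall>l\<in>{1..<L}. \<forall>u\<in>current_idx l. orbit_var T g u x \<in> favourable N m u}" for L
  define c where "c = (\<Prod>l\<in>{1..<m + 3}. w l)"
  have c: "0 < c"
    unfolding c_def w_def by (intro prod_pos prob_favourable_positive) auto
  have E_ge: "c / 2 \<le> prob (E L)" if "m + 3 \<le> L" for L
  proof -
    have le: "1 \<le> m + 3"
      by simp
    \<comment> \<open>The lower bounds \<open>1 - 4 / 2 ^ l\<close> must be nonnegative for the
      products to be compared factor by factor.\<close>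
    have "(4::real) / 2 ^ l \<le> 1" if "l \<ge> 2" for l
      using power_increasing[OF that, of "2::real"] by simp
    then have *: "4 / 2 ^ l \<in> {0..1::real}" if "l \<in> {m + 3..<L}" for l
      using that by auto
    \<comment> \<open>The exponent \<open>m + 3\<close> is at least 4, so the failures of all levels
      above \<open>m + 2\<close> add up to at most 1/2.\<close>
    have "(2::real) ^ 4 \<le> 2 ^ (m + 3)"
      using assms by (intro power_increasing) auto
    then have "8 / (2::real) ^ (m + 3) \<le> 1 / 2"
      by (simp add: field_simps)
    with sum_geometric_le[of "m + 3" L] have "1 / 2 \<le> 1 - (\<Sum>l\<in>{m + 3..<L}. 4 / (2::real) ^ l)"
      by linarith
    also have "\<dots> \<le> (\<Prod>l\<in>{m + 3..<L}. 1 - 4 / 2 ^ l)"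
      by (rule Weierstrass_prod_ineq) (rule *)
    also have "\<dots> \<le> (\<Prod>l\<in>{m + 3..<L}. w l)"
      unfolding w_def using * by (intro prod_mono conjI prob_favourable_zero assms) auto
    finally have "c * (1 / 2) \<le> c * (\<Prod>l\<in>{m + 3..<L}. w l)"
      using c by (intro mult_left_mono) auto
    also have "\<dots> = prob (E L)"
      unfolding c_def E_def prob_levels w_def[symmetric]
      by (rule prod.atLeastLessThan_concat[OF le that])
    finally show ?thesis
      by simp
  qed
  have E_sets: "E L \<in> events" for L
    unfolding E_def
  proof (intro sets.sets_Collect_finite_All)
    fix l u assume "l \<in> {1..<L}" "u \<in> current_idx l"
    then have [measurable]: "orbit_var T g u \<in> measurable M (count_space UNIV)"
      by (intro measurable_orbit_var_current) auto
    show "{x \<in> space M. orbit_var T g u x \<in> favourable N m u} \<in> events"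
      by measurable
  qed auto
  have "(\<lambda>L. prob (E L)) \<longlonglongrightarrow> prob (\<Inter>L. E L)"
    using E_sets by (intro finite_Lim_measure_decseq) (auto simp: decseq_def E_def)
  then have "c / 2 \<le> prob (\<Inter>L. E L)"
    by (rule LIMSEQ_le_const) (use E_ge in blast)
  moreover have "(\<Inter>L. E L) = favourable_event N m"
  proof (intro equalityI subsetI)
    fix x assume "x \<in> (\<Inter>L. E L)"
    then have x: "x \<in> E (Suc l)" for l
      by blast
    have "x \<in> space M"
      using x[of 0] by (simp add: E_def)
    moreover have "orbit_var T g u x \<in> favourable N m u" if "1 \<le> l" "u \<in> current_idx l" for l u
      using that x[of l] by (auto simp: E_def dest: bspec[where x=l])
    ultimately show "x \<in> favourable_event N m"
      unfolding favourable_event_def by blast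
  qed (auto simp: E_def favourable_event_def)
  ultimately show ?thesis
    using c by simp
qed

section \<open>The cocycle on the favourable event\<close>

lemma block_iterate:
  "block T g l i ((T ^^ n) x) =
    (\<Sum>j<pseq l. orbit_var T g (l, i, j + n) x - orbit_var T g (l, i, dseq l + j + n) x)"
  by (simp add: block_def orbit_var_def funpow_add)

lemma block_ge:
  assumes "1 \<le> l" "x \<in> space M"
  shows "- 2 * int (pseq l) \<le> block T g l 1 x"
proof -
  have "g l 1 ((T ^^ j) x) \<in> {-1, 0, 1}" for j
    using measurable_space[OF measurable_compose_n[OF measurable_T]] assms by (intro range_g) auto
  then have "- 2 \<le> g l 1 ((T ^^ j) x) - g l 1 ((T ^^ (dseq l + j)) x)" for j
    by (smt (verit) insert_iff empty_iff)
  then have "(\<Sum>j<pseq l. - 2) \<le> block T g l 1 x"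
    unfolding block_def by (intro sum_mono)
  then show ?thesis
    by simp
qed

lemma favourable_eventD:
  assumes "x \<in> favourable_event N m" "1 \<le> l" "j \<le> 2 * dseq l + pseq l"
  shows "orbit_var T g (l, 1, j) x \<in> favourable N m (l, 1, j)"
  using assms by (auto simp: favourable_event_def current_idx_def)

lemma block_favourable:
  assumes m: "2 * N + 2 \<le> m" "m < l" and x: "x \<in> favourable_event N m" and n: "n < 2 * N"
  shows "block T g l 1 ((T ^^ n) x) = (if l \<le> m + 2 then 2 * int (pseq l) else 0)"
proof -
  note bounds = window_bounds[OF m]
  let ?v = "if l \<le> m + 2 then 1 else 0 :: int"
  \<comment> \<open>Since \<open>j + n < pseq l + 2 * N \<le> dseq l\<close>, the first position
    lies before the sign change at \<open>dseq l\<close> and the second after it, still within the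
    window.\<close>
  have "orbit_var T g (l, 1, j + n) x = ?v \<and> orbit_var T g (l, 1, dseq l + j + n) x = - ?v"
    if "j < pseq l" for j
    using favourable_eventD[OF x, of l "j + n"] favourable_eventD[OF x, of l "dseq l + j + n"]
      that m n bounds
    by (auto simp: favourable_def split: if_splits)
  then have "block T g l 1 ((T ^^ n) x) = (\<Sum>j<pseq l. 2 * ?v)"
    unfolding block_iterate by (intro sum.cong) auto
  then show ?thesis
    by simp
qed

lemma cocycle_component_positive:
  assumes m: "2 * N + 2 \<le> m" and x: "x \<in> favourable_event N m" and n: "n < 2 * N"
  shows "0 < cocycle_component T g 1 ((T ^^ n) x)"
proof -
  let ?b = "\<lambda>k. block T g (Suc k) 1 ((T ^^ n) x)"
  have x': "(T ^^ n) x \<in> space M"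
    using x measurable_space[OF measurable_compose_n[OF measurable_T]]
    by (auto simp: favourable_event_def)
  have "cocycle_component T g 1 ((T ^^ n) x) = (\<Sum>k<m + 2. ?b k)"
    \<comment> \<open>Index \<open>k\<close> stands for level \<open>k + 1\<close>. The blocks above
      level \<open>m + 2\<close> vanish here, so the series is a finite sum and almost everywhere
      convergence is not invoked.\<close>
    unfolding cocycle_component_def
    by (rule suminf_finite) (use block_favourable[OF m _ x n] in auto)
  also have "\<dots> = (\<Sum>k<m. ?b k) + ?b m + ?b (Suc m)"
    by (simp add: add_2_eq_Suc')
  also have "?b m = 2 * int (pseq (Suc m))"
    using block_favourable[OF m _ x n, of "Suc m"] by simp
  also have "?b (Suc m) = 2 * int (pseq (Suc (Suc m)))"
    using block_favourable[OF m _ x n, of "Suc (Suc m)"] by simp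
  finally have "cocycle_component T g 1 ((T ^^ n) x) =
    (\<Sum>k<m. ?b k) + 2 * int (pseq (Suc m)) + 2 * int (pseq (Suc (Suc m)))" .
  moreover have "(\<Sum>k<m. - 2 * int (pseq (Suc k))) \<le> (\<Sum>k<m. ?b k)"
    by (intro sum_mono block_ge x') simp
  moreover have "(\<Sum>k<m. - 2 * int (pseq (Suc k))) = - 2 * int (\<Sum>k<m. pseq (Suc k))"
    by (simp add: sum_distrib_left)
  moreover have "int (\<Sum>k<m. pseq (Suc k)) < int (pseq (Suc m)) + int (pseq (Suc (Suc m)))"
    using sum_pseq_less[of m] by linarith
  ultimately show ?thesis
    by linarith
qed

lemma inj_birkhoff_sum:
  assumes "2 * N + 2 \<le> m" "x \<in> favourable_event N m"
  shows "inj_on (\<lambda>n. birkhoff_sum T (cocycle T g) n x) {..2 * N}"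
proof -
  have fst_sum: "fst (birkhoff_sum T (cocycle T g) n x) =
      (\<Sum>k<n. cocycle_component T g 1 ((T ^^ k) x))" for n
    by (induction n) (simp_all add: birkhoff_sum_def cocycle_def)
  have "fst (birkhoff_sum T (cocycle T g) i x) < fst (birkhoff_sum T (cocycle T g) j x)"
    if "i < j" "j \<le> 2 * N" for i j
    unfolding fst_sum
    \<comment> \<open>The longer sum has the extra positive term at index \<open>i\<close>; all
      indices are below \<open>j \<le> 2 * N\<close>, exactly the range where positivity is
      known.\<close>
    using that cocycle_component_positive[OF assms]
    by (intro sum_strict_mono2[where b=i]) (auto intro: less_imp_le)
  then show ?thesis
    by (intro linorder_inj_onI) fastforce+
qed

end

section \<open>From injectivity to the number of recentred sums\<close>

text \<open>The index \<open>j + int N\<close> runs through 0 to \<open>2 * N\<close>, so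
  \<open>nat\<close> truncates nothing, and subtracting the fixed \<open>F N\<close> is
  injective.\<close>

lemma card_recentred_iff_inj_on:
  fixes F :: "nat \<Rightarrow> 'b :: group_add"
  shows "card {F (nat (j + int N)) - F N | j :: int. - int N \<le> j \<and> j \<le> int N} = 2 * N + 1 \<longleftrightarrow>
    inj_on F {..2 * N}"
proof -
  have "{F (nat (j + int N)) - F N | j :: int. - int N \<le> j \<and> j \<le> int N} =
      (\<lambda>n. F n - F N) ` {..2 * N}" (is "?A = ?B")
  proof (intro equalityI subsetI)
    fix y assume "y \<in> ?B"
    then obtain n where "n \<le> 2 * N" "y = F n - F N"
      by auto
    then show "y \<in> ?A"
      by (intro CollectI exI[of _ "int n - int N"]) auto
  qed force
  then show ?thesis
    using inj_on_iff_eq_card[of "{..2 * N}" "\<lambda>n. F n - F N"] 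
    \<comment> \<open>Writing differences as sums exposes the right cancellation of
      \<open>- F N\<close>.\<close>
    by (simp add: inj_on_def diff_conv_add_uminus del: add_uminus_conv_diff)
qed

theorem proposition3p7:
  fixes M :: "'a measure" and T :: "'a \<Rightarrow> 'a" and g :: "nat \<Rightarrow> nat \<Rightarrow> 'a \<Rightarrow> int"
    and N :: nat
  assumes "ergodic_aperiodic_pps M T"
    and "base_functions M T g"
    and "N \<ge> 1"
  shows "measure M {x \<in> space M.
      card {birkhoff_sum T (cocycle T g) (nat (j + int N)) x - birkhoff_sum T (cocycle T g) N x |
            j :: int. - int N \<le> j \<and> j \<le> int N} = 2 * N + 1} > 0"
proof -
  interpret base_functions M T g
    by (rule assms(2))
  let ?S = "\<lambda>n x. birkhoff_sum T (cocycle T g) n x"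
  note [measurable] = measurable_birkhoff_sum
  \<comment> \<open>Monotonicity of the measure requires the larger set to be an event.\<close>
  have "{x \<in> space M. inj_on (\<lambda>n. ?S n x) {..2 * N}} \<in> events"
    unfolding inj_on_def by measurable
  then have "prob (favourable_event N (2 * N + 2)) \<le>
      prob {x \<in> space M. inj_on (\<lambda>n. ?S n x) {..2 * N}}"
    \<comment> \<open>The choice \<open>m = 2 * N + 2\<close> is the least one that the window
      bounds admit.\<close>
    using inj_birkhoff_sum[of N "2 * N + 2"]
    by (intro finite_measure_mono) (auto simp: favourable_event_def)
  then have "0 < prob {x \<in> space M. inj_on (\<lambda>n. ?S n x) {..2 * N}}"
    using prob_favourable_event[of N "2 * N + 2"] by simp
  then show ?thesis
    by (simp only: card_recentred_iff_inj_on[of "\<lambda>n. ?S n x" N for x])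
qed

end
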